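(* $\mathcal{B}$ is an affine invariant: for every $n\ge1$, every convex body $K\subset\mathbb{R}^n$, every $A\in GL(n,\mathbb{R})$ and every $a\in\mathbb{R}^n$, the convex body $S(K)=\{Ay+a: y\in K\}$ satisfies $\mathcal{B}(S(K))=\mathcal{B}(K)$.
   Context: A convex body in $\mathbb{R}^n$ is a compact convex set with non-empty interior; $|K|$ is its Lebesgue measure and $b(K)=\frac1{|K|}\int_K x\,dx$ its barycenter. The tube domain over $K$ is $T_K=\mathbb{R}^n+\sqrt{-1}\,(\mathrm{int}\,K)\subset\mathbb{C}^n$. $A^2(T_K)$ is the Hilbert space of holomorphic functions $f:T_K\to\mathbb{C}$ with $\|f\|_{L^2(T_K)}^2=\int_{T_K}|f|^2\,d\lambda<\infty$, where $\lambda$ is Lebesgue measure on $\mathbb{C}^n\cong\mathbb{R}^{2n}$. The Bergman kernel $\mathcal{K}_{T_K}:T_K\times T_K\to\mathbb{C}$ is the reproducing kernel of $A^2(T_K)$: for each $w\in T_K$, $\mathcal{K}_{T_K}(\cdot,w)\in A^2(T_K)$ and $f(w)=\int_{T_K}f(z)\overline{\mathcal{K}_{T_K}(z,w)}\,d\lambda(z)$ for all $f\in A^2(T_K)$. Define $$\mathcal{B}(K)=|K|^2\,\mathcal{K}_{T_K}\big(\sqrt{-1}\,b(K),\sqrt{-1}\,b(K)\big).$$ *)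

theory Defs
  imports "HOL-Analysis.Analysis"
begin

definition convex_body :: "(real ^ 'n) set \<Rightarrow> bool" where
  "convex_body K \<longleftrightarrow> compact K \<and> convex K \<and> interior K \<noteq> {}"

definition volume :: "(real ^ 'n) set \<Rightarrow> real" where
  "volume K = measure lborel K"

definition barycenter :: "(real ^ 'n) set \<Rightarrow> real ^ 'n" where
  "barycenter K = (1 / volume K) *\<^sub>R set_lebesgue_integral lborel K (\<lambda>x. x)"

definition tube_domain :: "(real ^ 'n) set \<Rightarrow> (complex ^ 'n) set" where
  "tube_domain K = {z. (\<chi> i. Im (z $ i)) \<in> interior K}"

definition imag_vec :: "real ^ 'n \<Rightarrow> complex ^ 'n" where
  "imag_vec y = (\<chi> i. \<i> * complex_of_real (y $ i))"

text \<open>Holomorphy in several variables: the real Frechet derivative exists at every point of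
  the open set \<open>T\<close> and is complex linear.\<close>

definition holomorphic_several :: "(complex ^ 'n \<Rightarrow> complex) \<Rightarrow> (complex ^ 'n) set \<Rightarrow> bool" where
  "holomorphic_several f T \<longleftrightarrow>
     (\<forall>z\<in>T. \<exists>f'. (f has_derivative f') (at z) \<and> (\<forall>c v. f' (c *s v) = c * f' v))"

text \<open>Elements are total functions; only their values on \<open>T\<close> matter. The measure \<open>lborel\<close> on
  \<open>complex ^ 'n\<close> is Lebesgue measure in the real and imaginary parts of the coordinates.\<close>

definition bergman_space :: "(complex ^ 'n) set \<Rightarrow> (complex ^ 'n \<Rightarrow> complex) set" where
  "bergman_space T =
     {f. holomorphic_several f T \<and> set_integrable lborel T (\<lambda>z. (cmod (f z))\<^sup>2)}"

definition is_bergman_kernel ::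
  "(complex ^ 'n) set \<Rightarrow> (complex ^ 'n \<Rightarrow> complex ^ 'n \<Rightarrow> complex) \<Rightarrow> bool" where
  "is_bergman_kernel T k \<longleftrightarrow>
     (\<forall>w\<in>T. (\<lambda>z. k z w) \<in> bergman_space T \<and>
        (\<forall>f\<in>bergman_space T. f w = set_lebesgue_integral lborel T (\<lambda>z. f z * cnj (k z w))))"

text \<open>A reproducing kernel is uniquely determined on \<open>T \<times> T\<close>, so the choice below is
  immaterial there. On open sets a kernel always exists (point evaluations are bounded on the
  Bergman space); the value \<open>0\<close> only makes the function total.\<close>

definition bergman_kernel ::
  "(complex ^ 'n) set \<Rightarrow> complex ^ 'n \<Rightarrow> complex ^ 'n \<Rightarrow> complex" where
  "bergman_kernel T z w =
     (if \<exists>k. is_bergman_kernel T k then (SOME k. is_bergman_kernel T k) z w else 0)"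

definition bergman_B :: "(real ^ 'n) set \<Rightarrow> complex" where
  "bergman_B K = complex_of_real ((volume K)\<^sup>2) *
     bergman_kernel (tube_domain K) (imag_vec (barycenter K)) (imag_vec (barycenter K))"

end

theory Submission
  imports Defs
begin

text \<open>The complexification \<open>L z = A z + \<i> a\<close> of the affine map \<open>y \<mapsto> A y + a\<close> is a biholomorphism of
  the tube over \<open>K\<close> onto the tube over the image of \<open>K\<close>. If \<open>A\<close> multiplies volume by \<open>1 / c\<close>, then \<open>L\<close>,
  which acts on real and imaginary parts separately by \<open>A\<close>, multiplies it by \<open>1 / c\<^sup>2\<close>. A change of
  variables in the reproducing identity then shows that the kernel is multiplied by \<open>c\<^sup>2\<close>, which
  the factor \<open>1 / c\<^sup>2\<close> of the squared volume cancels; the barycenter is carried along by the affine map.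

  It matters only that one scaling factor is the square of the other, not that \<open>1 / c = \<bar>det A\<bar>\<close>. So
  \<open>distr_lborel_linear_bijection\<close> obtains \<open>c\<close> without determinants, from the uniqueness of
  translation invariant measures, and \<open>distr_lborel_complexify\<close> compares \<open>complex ^ 'n\<close> with a product
  of two real spaces up to an unknown constant, which drops out.

  The kernel is a chosen object, so two more points need care. Its value at a point is determined by the
  reproducing property only inside the tube (\<open>bergman_kernels_agree\<close>), which is why the barycenter has to
  be an interior point of \<open>K\<close> (\<open>barycenter_in_interior\<close>). And existence of a kernel need not be known:
  a kernel can be transported along \<open>L\<close> in both directions, so it exists for both tubes or for
  neither, and then both sides are \<open>0\<close> (\<open>bergman_kernel_image\<close>).\<close>

section \<open>Lebesgue measure under linear bijections\<close>

text \<open>Uniqueness of Haar measure, by Tonelli's theorem: for the unit box \<open>B\<close>, computing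
  \<open>\<integral>\<integral> 1\<^sub>B(y) 1\<^sub>E(x + y)\<close> gives \<open>M(E)\<close> if \<open>x\<close> is integrated out first. Substituting \<open>y - x\<close> for \<open>y\<close> before
  integrating out \<open>x\<close> gives \<open>M(- B)\<close> times the Lebesgue measure of \<open>E\<close>.\<close>

lemma translation_invariant_measure_eq_density_lborel:
  fixes M :: "'a::euclidean_space measure"
  assumes sets_M: "sets M = sets borel"
    and finite_balls: "\<And>r. emeasure M (ball 0 r) < \<infinity>"
    and translation: "\<And>v. distr M borel (\<lambda>x. x + v) = M"
  shows "M = density lborel (\<lambda>_. emeasure M (box (- One) 0))"
proof -
  note [measurable_cong] = sets_M
  have space_M: "space M = UNIV"
    using sets_eq_imp_space_eq[OF sets_M] by simp
  interpret M: sigma_finite_measure M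
  proof
    have "(\<Union>n. ball 0 (real n)) = (UNIV :: 'a set)"
      using reals_Archimedean2 by (auto simp: dist_norm)
    then show "\<exists>\<A>. countable \<A> \<and> \<A> \<subseteq> sets M \<and> \<Union>\<A> = space M \<and> (\<forall>a\<in>\<A>. emeasure M a \<noteq> \<infinity>)"
      using finite_balls
      by (intro exI[of _ "range (\<lambda>n. ball 0 (real n))"]) (auto simp: sets_M space_M less_top)
  qed
  interpret pair_sigma_finite M lborel ..
  let ?B = "box 0 One :: 'a set"
  have box_measure: "emeasure lborel ?B = 1"
    by (simp add: emeasure_lborel_box_eq inner_diff_left)
  have reflect: "indicator ?B (y - x) = indicator (box (- One) 0) (x - y)" for x y :: 'a
    by (auto simp: indicator_def box_def inner_diff_left algebra_simps)
  have shift_M: "(\<integral>\<^sup>+x. h (x + v) \<partial>M) = (\<integral>\<^sup>+x. h x \<partial>M)"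
    if [measurable]: "h \<in> borel_measurable borel" for h :: "'a \<Rightarrow> ennreal" and v
    by (subst (2) translation[of v, symmetric], subst nn_integral_distr) auto
  have shift_lborel: "(\<integral>\<^sup>+x. h (v + x) \<partial>lborel) = (\<integral>\<^sup>+x. h x \<partial>lborel)"
    if [measurable]: "h \<in> borel_measurable borel" for h :: "'a \<Rightarrow> ennreal" and v
    by (subst (2) lborel_distr_plus[of v, symmetric], subst nn_integral_distr) auto
  show ?thesis
  proof (rule measure_eqI)
    show "sets M = sets (density lborel (\<lambda>_. emeasure M (box (- One) 0)))"
      by (simp add: sets_M)
    fix E assume "E \<in> sets M"
    then have E[measurable]: "E \<in> sets borel" by (simp add: sets_M)
    have "emeasure M E = (\<integral>\<^sup>+y. indicator ?B y * emeasure M E \<partial>lborel)"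
      by (simp add: nn_integral_multc box_measure)
    also have "\<dots> = (\<integral>\<^sup>+y. indicator ?B y * (\<integral>\<^sup>+x. indicator E x \<partial>M) \<partial>lborel)"
      by (simp add: sets_M)
    also have "\<dots> = (\<integral>\<^sup>+y. indicator ?B y * (\<integral>\<^sup>+x. indicator E (x + y) \<partial>M) \<partial>lborel)"
      by (subst shift_M) auto
    also have "\<dots> = (\<integral>\<^sup>+y. (\<integral>\<^sup>+x. indicator ?B y * indicator E (x + y) \<partial>M) \<partial>lborel)"
      by (subst nn_integral_cmult) auto
    also have "\<dots> = (\<integral>\<^sup>+x. (\<integral>\<^sup>+y. indicator ?B y * indicator E (x + y) \<partial>lborel) \<partial>M)"
      by (rule Fubini') measurable
    also have "\<dots> = (\<integral>\<^sup>+x. (\<integral>\<^sup>+y. indicator ?B (y - x) * indicator E y \<partial>lborel) \<partial>M)"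
      using shift_lborel[of "\<lambda>y. indicator ?B (y - x) * indicator E y" x for x]
      by simp
    also have "\<dots> = (\<integral>\<^sup>+y. (\<integral>\<^sup>+x. indicator ?B (y - x) * indicator E y \<partial>M) \<partial>lborel)"
      by (rule Fubini'[symmetric]) measurable
    also have "\<dots> = (\<integral>\<^sup>+y. (\<integral>\<^sup>+x. indicator (box (- One) 0) (x - y) \<partial>M) * indicator E y \<partial>lborel)"
      unfolding reflect by (subst nn_integral_multc) auto
    also have "\<dots> = (\<integral>\<^sup>+y. emeasure M (box (- One) 0) * indicator E y \<partial>lborel)"
      using shift_M[of "indicator (box (- One) 0)" "- y" for y] by (simp add: sets_M)
    also have "\<dots> = emeasure (density lborel (\<lambda>_. emeasure M (box (- One) 0))) E"
      by (simp add: emeasure_density)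
    finally show "emeasure M E = emeasure (density lborel (\<lambda>_. emeasure M (box (- One) 0))) E" .
  qed
qed

text \<open>The push-forward is translation invariant and finite on bounded sets, hence a multiple of
  Lebesgue measure. The map \<open>f\<close> divides volumes by \<open>c\<close>: as \<open>distr\<close> measures preimages, \<open>c\<close> is the
  factor of the inverse map.\<close>

lemma distr_lborel_linear_bijection:
  fixes f :: "'a::euclidean_space \<Rightarrow> 'b::euclidean_space" and g :: "'b \<Rightarrow> 'a"
  assumes f: "linear f" and g: "linear g"
    and gf: "\<And>x. g (f x) = x" and fg: "\<And>y. f (g y) = y"
  obtains c :: real where "0 < c" "distr lborel borel f = density lborel (\<lambda>_. ennreal c)"
proof -
  have [measurable]: "f \<in> borel_measurable borel"
    using f by (intro borel_measurable_continuous_onI linear_continuous_on linear_linear[THEN iffD2])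
  let ?M = "distr lborel borel f"
  have finite: "emeasure ?M S < \<infinity>" if "bounded S" "S \<in> sets borel" for S
  proof -
    have "f -` S = g ` S"
      by (auto simp: gf fg image_iff intro!: bexI[of _ "f x" for x])
    then have "bounded (f -` S)"
      using that g by (simp add: bounded_linear_image linear_linear)
    then show ?thesis
      using that emeasure_bounded_finite[of "f -` S"] by (simp add: emeasure_distr)
  qed
  have translation: "distr ?M borel (\<lambda>x. x + v) = ?M" for v
  proof -
    have "distr ?M borel (\<lambda>x. x + v) = distr lborel borel (\<lambda>x. f (g v + x))"
      by (subst distr_distr) (auto simp: o_def linear_add[OF f] fg add.commute)
    also have "\<dots> = distr (distr lborel borel ((+) (g v))) borel f"
      by (subst distr_distr) (auto simp: o_def)
    finally show ?thesis by (simp add: lborel_distr_plus)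
  qed
  define c where "c = enn2real (emeasure ?M (box (- One) 0))"
  have eq: "?M = density lborel (\<lambda>_. ennreal c)"
    using translation_invariant_measure_eq_density_lborel[of ?M] translation finite
    by (simp add: c_def bounded_box)
  have "c \<noteq> 0"
  proof
    assume "c = 0"
    \<comment> \<open>The push-forward has infinite total mass.\<close>
    with eq have "emeasure ?M UNIV = 0" by (simp add: emeasure_density)
    then show False by (simp add: emeasure_distr)
  qed
  then have "0 < c" by (simp add: c_def less_le)
  with eq show ?thesis by (rule that[rotated])
qed

lemma distr_lborel_translate:
  fixes f :: "'a::euclidean_space \<Rightarrow> 'b::euclidean_space"
  assumes [measurable]: "f \<in> borel_measurable borel"
    and eq: "distr lborel borel f = density lborel (\<lambda>_. ennreal c)"
  shows "distr lborel borel (\<lambda>x. f x + v) = density lborel (\<lambda>_. ennreal c)"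
proof -
  have "distr lborel borel (\<lambda>x. f x + v) = distr (distr lborel borel f) borel ((+) v)"
    by (subst distr_distr) (auto simp: o_def add.commute)
  also have "\<dots> = distr (density lborel (\<lambda>_. ennreal c)) borel ((+) v)"
    by (simp add: eq)
  also have "\<dots> = density (distr lborel borel ((+) v)) (\<lambda>_. ennreal c)"
    by (subst density_distr) auto
  finally show ?thesis by (simp add: lborel_distr_plus)
qed

lemma integral_change_of_variables_scaling:
  fixes h :: "'b::euclidean_space \<Rightarrow> 'c::{banach, second_countable_topology}"
  assumes [measurable]: "L \<in> borel_measurable borel" "h \<in> borel_measurable borel"
    and eq: "distr lborel borel L = density lborel (\<lambda>_. ennreal c)" and "0 < c"
  shows "(LINT x|lborel. h (L x)) = c *\<^sub>R (LINT y|lborel. h y)"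
    and "integrable lborel (\<lambda>x. h (L x)) \<longleftrightarrow> integrable lborel h"
proof -
  have "(LINT x|lborel. h (L x)) = (LINT y|distr lborel borel L. h y)"
    by (subst integral_distr) auto
  also have "\<dots> = c *\<^sub>R (LINT y|lborel. h y)"
    using \<open>0 < c\<close> by (simp add: eq integral_density)
  finally show "(LINT x|lborel. h (L x)) = c *\<^sub>R (LINT y|lborel. h y)" .
  have "integrable lborel (\<lambda>x. h (L x)) \<longleftrightarrow> integrable (distr lborel borel L) h"
    by (subst integrable_distr_eq) auto
  also have "\<dots> \<longleftrightarrow> integrable lborel h"
    using \<open>0 < c\<close> integrable_scaleR_right[of "inverse c" lborel "\<lambda>y. c *\<^sub>R h y"]
    by (auto simp: eq integrable_density)
  finally show "integrable lborel (\<lambda>x. h (L x)) \<longleftrightarrow> integrable lborel h" .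
qed

section \<open>Complexification of a real matrix\<close>

definition complexify :: "real ^ 'n ^ 'm \<Rightarrow> complex ^ 'n ^ 'm" where
  "complexify A = map_matrix complex_of_real A"

lemma complexify_mult: "complexify A ** complexify B = complexify (A ** B)"
  by (simp add: complexify_def matrix_matrix_mult_def map_matrix_def vec_eq_iff)

lemma complexify_mat_1: "complexify (mat 1) = mat 1"
  by (simp add: complexify_def mat_def map_matrix_def vec_eq_iff)

lemma linear_complex_matrix_vector_mult:
  "linear (\<lambda>z. (M :: complex ^ 'n ^ 'm) *v z)"
  by (rule linearI)
     (simp_all add: vec_eq_iff matrix_vector_mult_def algebra_simps sum.distrib scaleR_sum_right)

text \<open>Splitting into real and imaginary parts conjugates \<open>complexify A\<close> to \<open>A \<times> A\<close>, whose factor on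
  the product measure is \<open>c\<^sup>2\<close>. The splitting \<open>\<Phi>\<close> itself scales Lebesgue measure by some constant \<open>e\<close>;
  it occurs on both sides of the resulting identity and is cancelled.\<close>

lemma distr_lborel_complexify:
  fixes A :: "real ^ 'n ^ 'n"
  assumes c: "0 < c" and real: "distr lborel borel ((*v) A) = density lborel (\<lambda>_. ennreal c)"
  shows "distr lborel borel ((*v) (complexify A)) = density lborel (\<lambda>_. ennreal (c\<^sup>2))"
proof -
  define \<Phi> :: "(real ^ 'n) \<times> (real ^ 'n) \<Rightarrow> complex ^ 'n"
    where "\<Phi> = (\<lambda>(x, y). \<chi> i. Complex (x $ i) (y $ i))"
  define \<Psi> :: "complex ^ 'n \<Rightarrow> (real ^ 'n) \<times> (real ^ 'n)"
    where "\<Psi> = (\<lambda>z. (\<chi> i. Re (z $ i), \<chi> i. Im (z $ i)))"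
  have lin: "linear \<Phi>" "linear \<Psi>"
    by (rule linearI; auto simp: \<Phi>_def \<Psi>_def vec_eq_iff complex_eq_iff split: prod.splits)+
  obtain e where e: "0 < e" "distr lborel borel \<Phi> = density lborel (\<lambda>_. ennreal e)"
    by (rule distr_lborel_linear_bijection[OF lin])
       (auto simp: \<Phi>_def \<Psi>_def vec_eq_iff)
  let ?AA = "\<lambda>(x, y). (A *v x, A *v y)"
  have [measurable]: "(*v) A \<in> borel_measurable borel" "\<Phi> \<in> borel_measurable borel"
    "(*v) (complexify A) \<in> borel_measurable borel"
    using lin(1) linear_complex_matrix_vector_mult[of "complexify A"]
    by (auto intro!: borel_measurable_continuous_onI linear_continuous_on simp: linear_linear
         matrix_vector_mul_bounded_linear)
  have [measurable]: "?AA \<in> borel_measurable borel"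
    unfolding borel_prod[symmetric] by measurable
  have sf: "sigma_finite_measure (density lborel (\<lambda>_::real^'n. ennreal c))"
    by (subst sigma_finite_measure.sigma_finite_iff_density_finite[OF lborel.sigma_finite_measure_axioms]) auto
  have "distr lborel borel ?AA = distr (lborel \<Otimes>\<^sub>M lborel) (borel \<Otimes>\<^sub>M borel) ?AA"
    by (simp add: lborel_prod borel_prod)
  also have "\<dots> = distr lborel borel ((*v) A) \<Otimes>\<^sub>M distr lborel borel ((*v) A)"
    by (subst pair_measure_distr) (auto simp: real sf)
  also have "\<dots> = density (lborel \<Otimes>\<^sub>M lborel) (\<lambda>_. ennreal (c\<^sup>2))"
    unfolding real using c
    by (subst pair_measure_density)
       (auto simp: sf lborel.sigma_finite_measure_axioms power2_eq_square ennreal_mult case_prod_unfold)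
  also have "\<dots> = density lborel (\<lambda>_. ennreal (c\<^sup>2))"
    by (simp add: lborel_prod)
  finally have AA: "distr lborel borel ?AA = density lborel (\<lambda>_. ennreal (c\<^sup>2))" .
  have intertwine: "complexify A *v \<Phi> p = \<Phi> (?AA p)" for p
    by (auto simp: \<Phi>_def complexify_def matrix_vector_mult_def vec_eq_iff complex_eq_iff
        split: prod.splits)
  have "density (distr lborel borel ((*v) (complexify A))) (\<lambda>_. ennreal e)
      = distr (density lborel (\<lambda>_. ennreal e)) borel ((*v) (complexify A))"
    by (subst density_distr) auto
  also have "\<dots> = distr lborel borel (\<lambda>p. complexify A *v \<Phi> p)"
    unfolding e(2)[symmetric] by (subst distr_distr) (auto simp: o_def)
  also have "\<dots> = distr (distr lborel borel ?AA) borel \<Phi>"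
    unfolding intertwine by (subst distr_distr) (auto simp: o_def)
  also have "\<dots> = density (density lborel (\<lambda>_. ennreal e)) (\<lambda>_. ennreal (c\<^sup>2))"
    unfolding AA e(2)[symmetric] by (subst density_distr) auto
  finally have *: "density (distr lborel borel ((*v) (complexify A))) (\<lambda>_. ennreal e)
    = density (density lborel (\<lambda>_. ennreal e)) (\<lambda>_. ennreal (c\<^sup>2))" .
  have "density (density (distr lborel borel ((*v) (complexify A))) (\<lambda>_. ennreal e)) (\<lambda>_. ennreal (1 / e))
    = distr lborel borel ((*v) (complexify A))"
    using e(1) by (subst density_density_eq) (auto simp: ennreal_mult[symmetric] density_1)
  moreover have "density (density (density lborel (\<lambda>_::complex^'n. ennreal e)) (\<lambda>_. ennreal (c\<^sup>2))) (\<lambda>_. ennreal (1 / e))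
    = density lborel (\<lambda>_. ennreal (c\<^sup>2))"
    using e(1) by (simp add: density_density_eq ennreal_mult[symmetric])
  ultimately show ?thesis using * by simp
qed

section \<open>Volume and barycenter of a convex body\<close>

lemma open_eq_empty_if_AE_notin:
  fixes U :: "'a::euclidean_space set"
  assumes "open U" "AE x in lborel. x \<notin> U"
  shows "U = {}"
proof (rule ccontr)
  assume "U \<noteq> {}"
  have "U \<in> null_sets lborel"
    using assms by (subst AE_iff_null_sets) auto
  then have "U \<in> null_sets lebesgue"
    by (rule null_sets_completionI)
  then have "negligible U"
    by (simp add: negligible_iff_null_sets)
  then show False
    using open_not_negligible[OF \<open>open U\<close> \<open>U \<noteq> {}\<close>] by simp
qed

lemma volume_convex_body_pos:
  assumes "convex_body K"
  shows "0 < volume K"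
proof (rule ccontr)
  assume "\<not> 0 < volume K"
  then have "measure lborel K = 0"
    by (simp add: volume_def not_less measure_le_0_iff)
  moreover have "compact K"
    using assms by (simp add: convex_body_def)
  ultimately have "K \<in> null_sets lborel"
    using emeasure_compact_finite[of K]
    by (auto simp: null_sets_def borel_compact measure_def enn2real_eq_0_iff)
  then have "AE x in lborel. x \<notin> interior K"
    by (rule AE_I'[of _ _ "\<lambda>x. x \<notin> interior K"]) (use interior_subset in auto)
  then show False
    using assms open_eq_empty_if_AE_notin[of "interior K"] by (simp add: convex_body_def)
qed

lemma set_integrable_compact_id:
  fixes K :: "'a::euclidean_space set"
  assumes "compact K"
  shows "set_integrable lborel K (\<lambda>x. x)"
  unfolding set_integrable_def using borel_integrable_compact[OF assms continuous_on_id] by simp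

text \<open>Otherwise a hyperplane through the barycenter has \<open>K\<close> on one side. The mean over \<open>K\<close> of the
  signed distance to this hyperplane is \<open>0\<close>, so the distance vanishes almost everywhere on \<open>K\<close>, but it is
  strictly positive at interior points.\<close>

lemma barycenter_in_interior:
  assumes "convex_body K"
  shows "barycenter K \<in> interior K"
proof (rule ccontr)
  let ?b = "barycenter K"
  assume "?b \<notin> interior K"
  have K: "compact K" "convex K" "interior K \<noteq> {}"
    using assms by (auto simp: convex_body_def)
  have vol: "0 < volume K"
    by (rule volume_convex_body_pos[OF assms])
  have "\<exists>u c. u \<noteq> 0 \<and> (\<forall>x\<in>interior K. u \<bullet> x \<le> c) \<and> (\<forall>x\<in>{?b}. u \<bullet> x \<ge> c)"
    using K \<open>?b \<notin> interior K\<close> by (intro separating_hyperplane_sets) (auto simp: convex_interior)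
  then obtain u where u: "u \<noteq> 0" and le_interior: "\<And>x. x \<in> interior K \<Longrightarrow> u \<bullet> x \<le> u \<bullet> ?b"
    by force
  have le: "u \<bullet> x \<le> u \<bullet> ?b" if "x \<in> K" for x
  proof -
    have "x \<in> closure (interior K)"
      using that K convex_closure_interior[of K] closure_subset by auto
    then show ?thesis
      by (rule continuous_le_on_closure[rotated 1]) (auto intro!: continuous_intros le_interior)
  qed
  have less: "u \<bullet> x < u \<bullet> ?b" if x: "x \<in> interior K" for x
  proof -
    \<comment> \<open>Moving from an interior point towards the hyperplane stays inside for a while.\<close>
    obtain e where e: "0 < e" "cball x e \<subseteq> interior K"
      using x open_contains_cball[of "interior K"] by auto
    have "x + (e / norm u) *\<^sub>R u \<in> cball x e"
      using e u by (simp add: dist_norm)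
    then have "u \<bullet> (x + (e / norm u) *\<^sub>R u) \<le> u \<bullet> ?b"
      using e le_interior by blast
    moreover have "0 < (e / norm u) * (u \<bullet> u)"
      using e u by simp
    ultimately show ?thesis by (simp add: inner_add_right)
  qed
  note int_id = set_integrable_compact_id[OF K(1), unfolded set_integrable_def]
  have int_const: "integrable lborel (\<lambda>x. indicator K x * (u \<bullet> ?b))"
    using borel_integrable_compact[OF K(1) continuous_on_const[of K "u \<bullet> ?b"]] by simp
  have int_inner: "integrable lborel (\<lambda>x. u \<bullet> (indicator K x *\<^sub>R x))"
    using int_id by (intro integrable_inner_right) auto
  let ?g = "\<lambda>x. indicator K x * (u \<bullet> ?b) - u \<bullet> (indicator K x *\<^sub>R x)"
  have "(LINT x|lborel. indicator K x *\<^sub>R x) = volume K *\<^sub>R ?b"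
    using vol by (simp add: barycenter_def set_lebesgue_integral_def)
  moreover have "(LINT x|lborel. u \<bullet> (indicator K x *\<^sub>R x)) = u \<bullet> (LINT x|lborel. indicator K x *\<^sub>R x)"
    by (rule integral_inner_right) (rule int_id)
  moreover have "(LINT x|lborel. indicator K x * (u \<bullet> ?b)) = volume K * (u \<bullet> ?b)"
    by (simp add: volume_def)
  ultimately have "(LINT x|lborel. ?g x) = 0"
    by (subst Bochner_Integration.integral_diff[OF int_const int_inner]) simp
  moreover have "AE x in lborel. 0 \<le> ?g x"
    using le by (auto simp: indicator_def)
  ultimately have "AE x in lborel. ?g x = 0"
    using int_const int_inner by (subst (asm) integral_nonneg_eq_0_iff_AE) auto
  then have "AE x in lborel. x \<notin> interior K"
    by eventually_elim (use less interior_subset in \<open>fastforce simp: indicator_def\<close>)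
  then show False
    using K open_eq_empty_if_AE_notin[of "interior K"] by simp
qed

lemma convex_body_affine_image:
  fixes A B :: "real ^ 'n ^ 'n"
  assumes "convex_body K" and BA: "B ** A = mat 1"
  shows "convex_body ((\<lambda>y. A *v y + a) ` K)"
    and "interior ((\<lambda>y. A *v y + a) ` K) = (\<lambda>y. A *v y + a) ` interior K"
proof -
  have split: "(\<lambda>y. A *v y + a) ` S = (+) a ` ((*v) A ` S)" for S
    by (auto simp: image_image add.commute)
  have "inj ((*v) A)"
    by (rule inj_on_inverseI[of _ "(*v) B"]) (simp add: matrix_vector_mul_assoc BA)
  then show interior: "interior ((\<lambda>y. A *v y + a) ` K) = (\<lambda>y. A *v y + a) ` interior K"
    unfolding split interior_translation by (subst interior_injective_linear_image) auto
  have "compact ((\<lambda>y. A *v y + a) ` K)" "convex ((\<lambda>y. A *v y + a) ` K)"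
    using assms unfolding split convex_body_def
    by (auto intro!: compact_translation convex_translation convex_linear_image
        compact_continuous_image linear_continuous_on)
  then show "convex_body ((\<lambda>y. A *v y + a) ` K)"
    using assms interior by (simp add: convex_body_def)
qed

lemma volume_and_barycenter_affine_image:
  fixes A B :: "real ^ 'n ^ 'n"
  assumes K: "convex_body K" and BA: "B ** A = mat 1"
    and c: "0 < c" "distr lborel borel ((*v) A) = density lborel (\<lambda>_. ennreal c)"
  shows "volume K = c * volume ((\<lambda>y. A *v y + a) ` K)"
    and "barycenter ((\<lambda>y. A *v y + a) ` K) = A *v barycenter K + a"
proof -
  let ?S = "\<lambda>y. A *v y + a"
  have compact: "compact K" "compact (?S ` K)"
    using K convex_body_affine_image[OF K BA] by (auto simp: convex_body_def)
  then have [measurable]: "K \<in> sets borel" "?S ` K \<in> sets borel"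
    by (auto intro: borel_compact)
  have [measurable]: "(*v) A \<in> borel_measurable borel"
    by (intro borel_measurable_continuous_onI linear_continuous_on matrix_vector_mul_bounded_linear)
  have distr: "distr lborel borel ?S = density lborel (\<lambda>_. ennreal c)"
    by (rule distr_lborel_translate) (use c in auto)
  have "inj ?S"
    by (rule inj_on_inverseI[of _ "\<lambda>y. B *v (y - a)"]) (simp add: matrix_vector_mul_assoc BA)
  then have indicator: "indicator (?S ` K) (?S x) = (indicator K x :: real)" for x
    using inj_image_mem_iff[OF \<open>inj ?S\<close>] by (simp add: indicator_def)
  show vol: "volume K = c * volume (?S ` K)"
    using integral_change_of_variables_scaling(1)
      [of ?S "indicator (?S ` K) :: _ \<Rightarrow> real", OF _ _ distr c(1)]
    by (simp add: indicator volume_def)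
  have pos: "0 < volume K" "0 < volume (?S ` K)"
    using volume_convex_body_pos K convex_body_affine_image[OF K BA] by auto
  note int_id = set_integrable_compact_id[OF compact(1), unfolded set_integrable_def]
  have int_const: "integrable lborel (\<lambda>x. indicator K x *\<^sub>R a)"
    by (rule borel_integrable_compact[OF compact(1) continuous_on_const])
  have "integrable lborel (indicator K :: _ \<Rightarrow> real)"
    using borel_integrable_compact[OF compact(1) continuous_on_const[of K "1 :: real"]] by simp
  then have lint_const: "(LINT x|lborel. indicator K x *\<^sub>R a) = volume K *\<^sub>R a"
    by (subst Bochner_Integration.integral_scaleR_left) (simp_all add: volume_def)
  have "c *\<^sub>R (LINT y|lborel. indicator (?S ` K) y *\<^sub>R y)
      = (LINT x|lborel. indicator K x *\<^sub>R ?S x)"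
    using integral_change_of_variables_scaling(1)
      [of ?S "\<lambda>y. indicator (?S ` K) y *\<^sub>R y", OF _ _ distr c(1)]
    by (simp add: indicator)
  also have "\<dots> = (LINT x|lborel. A *v (indicator K x *\<^sub>R x) + indicator K x *\<^sub>R a)"
    by (simp add: scaleR_add_right linear_scale[OF matrix_vector_mul_linear])
  also have "\<dots> = A *v (LINT x|lborel. indicator K x *\<^sub>R x) + volume K *\<^sub>R a"
    using int_id int_const
    by (simp add: lint_const integrable_bounded_linear[OF matrix_vector_mul_bounded_linear]
        integral_bounded_linear[OF matrix_vector_mul_bounded_linear])
  also have "\<dots> = volume K *\<^sub>R (A *v barycenter K + a)"
    using pos by (simp add: barycenter_def set_lebesgue_integral_def scaleR_add_right
        linear_scale[OF matrix_vector_mul_linear])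
  finally have "c *\<^sub>R (LINT y|lborel. indicator (?S ` K) y *\<^sub>R y)
      = c *\<^sub>R (volume (?S ` K) *\<^sub>R (A *v barycenter K + a))"
    by (simp add: vol)
  then have "(LINT y|lborel. indicator (?S ` K) y *\<^sub>R y)
      = volume (?S ` K) *\<^sub>R (A *v barycenter K + a)"
    using c(1) by (subst (asm) scaleR_cancel_left) simp
  then show "barycenter (?S ` K) = A *v barycenter K + a"
    unfolding barycenter_def[of "?S ` K"] set_lebesgue_integral_def using pos(2) by simp
qed

section \<open>Reproducing kernels and biholomorphisms\<close>

text \<open>Reproducing \<open>k(\<cdot>, w)\<close> by \<open>l(\<cdot>, z)\<close>, and \<open>l(\<cdot>, z)\<close> by \<open>k(\<cdot>, w)\<close>, evaluates the same inner product
  up to conjugation, so \<open>k(z, w)\<close> is the conjugate of \<open>l(w, z)\<close>. With \<open>k = l\<close> this is the Hermitian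
  symmetry of \<open>l\<close>, and the two statements together give uniqueness.\<close>

lemma bergman_kernels_agree:
  assumes k: "is_bergman_kernel T k" and l: "is_bergman_kernel T l" and "z \<in> T" "w \<in> T"
  shows "k z w = l z w"
proof -
  have swap: "k z w = cnj (l w z)" if "is_bergman_kernel T k" "is_bergman_kernel T l" "z \<in> T" "w \<in> T"
    for k l z w
  proof -
    have "k z w = set_lebesgue_integral lborel T (\<lambda>x. k x w * cnj (l x z))"
      using that by (simp add: is_bergman_kernel_def)
    also have "\<dots> = cnj (set_lebesgue_integral lborel T (\<lambda>x. l x z * cnj (k x w)))"
      unfolding set_lebesgue_integral_def Bochner_Integration.integral_cnj[symmetric]
      by (simp add: mult.commute)
    also have "set_lebesgue_integral lborel T (\<lambda>x. l x z * cnj (k x w)) = l w z"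
      using that by (simp add: is_bergman_kernel_def)
    finally show ?thesis .
  qed
  have "k z w = cnj (l w z)" "l z w = cnj (l w z)"
    using swap assms by blast+
  then show ?thesis by simp
qed

lemma bergman_kernel_eqI:
  assumes "is_bergman_kernel T k" "z \<in> T" "w \<in> T"
  shows "bergman_kernel T z w = k z w"
proof -
  have "is_bergman_kernel T (SOME k. is_bergman_kernel T k)"
    using assms(1) by (rule someI[where P = "is_bergman_kernel T"])
  then show ?thesis
    using assms bergman_kernels_agree unfolding bergman_kernel_def by (metis (full_types))
qed

lemma bergman_space_cmult:
  assumes "f \<in> bergman_space T"
  shows "(\<lambda>z. c * f z) \<in> bergman_space T"
proof -
  have "holomorphic_several (\<lambda>z. c * f z) T"
    unfolding holomorphic_several_def
  proof
    fix z assume "z \<in> T"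
    then obtain f' where "(f has_derivative f') (at z)" "\<forall>a v. f' (a *s v) = a * f' v"
      using assms by (auto simp: bergman_space_def holomorphic_several_def)
    then show "\<exists>g'. ((\<lambda>z. c * f z) has_derivative g') (at z) \<and> (\<forall>a v. g' (a *s v) = a * g' v)"
      by (intro exI[of _ "\<lambda>v. c * f' v"]) (auto intro!: has_derivative_mult_right simp: mult.left_commute)
  qed
  moreover have "set_integrable lborel T (\<lambda>z. (cmod (c * f z))\<^sup>2)"
    using assms by (simp add: bergman_space_def norm_mult power_mult_distrib)
  ultimately show ?thesis by (simp add: bergman_space_def)
qed

text \<open>Elements of the space are arbitrary outside \<open>T\<close>, so only the truncation can be measurable.\<close>

lemma bergman_space_measurable:
  assumes "f \<in> bergman_space T" "open T"
  shows "(\<lambda>z. indicator T z *\<^sub>R f z) \<in> borel_measurable borel"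
proof -
  have "continuous_on T f"
    using assms unfolding bergman_space_def holomorphic_several_def
    by (blast intro: continuous_at_imp_continuous_on has_derivative_continuous)
  then show ?thesis
    using \<open>open T\<close> by (intro borel_measurable_continuous_on_indicator) auto
qed

text \<open>Biholomorphisms of the whole space with constant Jacobian, such as affine ones. The conditions
  are symmetric in \<open>L\<close> and \<open>L'\<close> up to inverting \<open>d\<close>, so every result below also applies to \<open>L'\<close>.\<close>

locale volume_scaling_biholomorphism =
  fixes L L' :: "complex ^ 'n \<Rightarrow> complex ^ 'n" and d :: real
  assumes d_pos: "0 < d"
    and L'_L [simp]: "L' (L z) = z" and L_L' [simp]: "L (L' z) = z"
    and deriv_L: "\<exists>D. (L has_derivative D) (at z) \<and> (\<forall>c v. D (c *s v) = c *s D v)"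
    and deriv_L': "\<exists>D. (L' has_derivative D) (at z) \<and> (\<forall>c v. D (c *s v) = c *s D v)"
    and distr_L: "distr lborel borel L = density lborel (\<lambda>_. ennreal d)"
begin

lemma continuous_L: "continuous_on UNIV L" and continuous_L': "continuous_on UNIV L'"
  using deriv_L deriv_L' by (meson continuous_at_imp_continuous_on has_derivative_continuous)+

lemma measurable_L [measurable]: "L \<in> borel_measurable borel" "L' \<in> borel_measurable borel"
  using continuous_L continuous_L' by (auto intro: borel_measurable_continuous_onI)

lemma image_L: "L ` T = L' -` T" and image_L': "L' ` L ` T = T"
  by (auto simp: image_image image_iff) (metis L_L')

lemma open_image: "open T \<Longrightarrow> open (L ` T)"
  unfolding image_L using continuous_L' by (simp add: open_vimage)

lemma indicator_image: "indicator (L ` T) (L z) = indicator T z"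
  by (auto simp: indicator_def image_L)

lemma inverse: "volume_scaling_biholomorphism L' L (1 / d)"
proof
  have "lborel = distr (distr lborel borel L) borel L'"
    by (subst distr_distr) (auto simp: o_def distr_id2)
  also have "\<dots> = density (distr lborel borel L') (\<lambda>_. ennreal d)"
    unfolding distr_L by (subst density_distr) auto
  finally have "density lborel (\<lambda>_. ennreal (1 / d))
      = density (density (distr lborel borel L') (\<lambda>_. ennreal d)) (\<lambda>_. ennreal (1 / d))"
    by (rule arg_cong)
  also have "\<dots> = distr lborel borel L'"
    using d_pos by (subst density_density_eq) (auto simp: ennreal_mult[symmetric] density_1)
  finally show "distr lborel borel L' = density lborel (\<lambda>_. ennreal (1 / d))" ..
next
  show "0 < 1 / d" using d_pos by simp
qed (rule L_L' L'_L deriv_L deriv_L')+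

lemma bergman_space_comp:
  assumes f: "f \<in> bergman_space (L ` T)"
  shows "(\<lambda>z. f (L z)) \<in> bergman_space T"
proof -
  have "holomorphic_several (\<lambda>z. f (L z)) T"
    unfolding holomorphic_several_def
  proof
    fix z assume "z \<in> T"
    then obtain f' where f': "(f has_derivative f') (at (L z))" "\<forall>a v. f' (a *s v) = a * f' v"
      using f by (auto simp: bergman_space_def holomorphic_several_def)
    obtain D where D: "(L has_derivative D) (at z)" "\<forall>c v. D (c *s v) = c *s D v"
      using deriv_L by blast
    show "\<exists>g'. ((\<lambda>z. f (L z)) has_derivative g') (at z) \<and> (\<forall>a v. g' (a *s v) = a * g' v)"
      using diff_chain_at[OF D(1) f'(1)] D(2) f'(2)
      by (intro exI[of _ "\<lambda>v. f' (D v)"]) (auto simp: o_def)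
  qed
  moreover have "set_integrable lborel T (\<lambda>z. (cmod (f (L z)))\<^sup>2)"
  proof -
    have "integrable lborel (\<lambda>y. indicator (L ` T) y *\<^sub>R (cmod (f y))\<^sup>2)"
      using f by (simp add: bergman_space_def set_integrable_def)
    then have "integrable lborel (\<lambda>z. indicator (L ` T) (L z) *\<^sub>R (cmod (f (L z)))\<^sup>2)"
      using borel_measurable_integrable
      by (subst integral_change_of_variables_scaling(2)[OF _ _ distr_L d_pos]) fastforce+
    then show ?thesis
      by (simp add: set_integrable_def indicator_image)
  qed
  ultimately show ?thesis by (simp add: bergman_space_def)
qed

text \<open>The general transformation law of the kernel contains the complex Jacobian determinants at both
  points; for a constant Jacobian, their product is the real volume factor \<open>d\<close> of the inverse map.\<close>

lemma is_bergman_kernel_image: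
  assumes T: "open T" and k: "is_bergman_kernel T k"
  shows "is_bergman_kernel (L ` T) (\<lambda>z w. complex_of_real d * k (L' z) (L' w))"
  unfolding is_bergman_kernel_def
proof (intro ballI conjI)
  fix w assume "w \<in> L ` T"
  then have w: "L' w \<in> T" by (simp add: image_L)
  interpret inv: volume_scaling_biholomorphism L' L "1 / d" by (rule inverse)
  have "(\<lambda>z. k z (L' w)) \<in> bergman_space (L' ` L ` T)"
    using k w by (simp add: is_bergman_kernel_def image_L')
  then have kL': "(\<lambda>z. k (L' z) (L' w)) \<in> bergman_space (L ` T)"
    by (rule inv.bergman_space_comp)
  then show "(\<lambda>z. complex_of_real d * k (L' z) (L' w)) \<in> bergman_space (L ` T)"
    by (rule bergman_space_cmult)
  fix f assume f: "f \<in> bergman_space (L ` T)"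
  let ?h = "\<lambda>y. indicator (L ` T) y *\<^sub>R (f y * cnj (k (L' y) (L' w)))"
  have h_eq: "?h = (\<lambda>y. (indicator (L ` T) y *\<^sub>R f y) * cnj (indicator (L ` T) y *\<^sub>R k (L' y) (L' w)))"
    by (auto simp: indicator_def)
  have h[measurable]: "?h \<in> borel_measurable borel"
    unfolding h_eq using bergman_space_measurable[OF f] bergman_space_measurable[OF kL'] open_image[OF T]
    by (intro borel_measurable_times measurable_compose[OF _ borel_measurable_continuous_onI[of cnj]])
       (auto intro: continuous_intros)
  have "f w = f (L (L' w))" by simp
  also have "\<dots> = (LINT z|lborel. indicator T z *\<^sub>R (f (L z) * cnj (k z (L' w))))"
    using k w bergman_space_comp[OF f] by (simp add: is_bergman_kernel_def set_lebesgue_integral_def)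
  also have "\<dots> = (LINT z|lborel. ?h (L z))"
    by (simp add: indicator_image)
  also have "\<dots> = d *\<^sub>R (LINT y|lborel. ?h y)"
    by (rule integral_change_of_variables_scaling(1)[OF _ h distr_L d_pos]) measurable
  also have "\<dots> = (LINT y|lborel. d *\<^sub>R ?h y)"
    by (rule Bochner_Integration.integral_scaleR_right[symmetric])
  also have "\<dots> = (LINT y:L ` T|lborel. f y * cnj (complex_of_real d * k (L' y) (L' w)))"
    unfolding set_lebesgue_integral_def
    by (rule Bochner_Integration.integral_cong) (auto simp: scaleR_conv_of_real)
  finally show "f w = (LINT y:L ` T|lborel. f y * cnj (complex_of_real d * k (L' y) (L' w)))" .
qed

text \<open>If \<open>T\<close> has no kernel, then neither has \<open>L ` T\<close>, since \<open>L'\<close> would carry it back; both sides are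
  then \<open>0\<close> by the convention for a missing kernel.\<close>

lemma bergman_kernel_image:
  assumes T: "open T" and "z \<in> T" "w \<in> T"
  shows "bergman_kernel (L ` T) (L z) (L w) = complex_of_real d * bergman_kernel T z w"
proof (cases "\<exists>k. is_bergman_kernel T k")
  case True
  then obtain k where k: "is_bergman_kernel T k" ..
  show ?thesis
    using bergman_kernel_eqI[OF is_bergman_kernel_image[OF T k], of "L z" "L w"]
      bergman_kernel_eqI[OF k] assms by simp
next
  case False
  interpret inv: volume_scaling_biholomorphism L' L "1 / d" by (rule inverse)
  have "\<nexists>k. is_bergman_kernel (L ` T) k"
    using False inv.is_bergman_kernel_image[OF open_image[OF T]] by (auto simp: image_L')
  with False show ?thesis by (simp add: bergman_kernel_def)
qed

end

section \<open>Tube domains under affine maps\<close>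

lemma volume_scaling_biholomorphism_complexify:
  fixes A B :: "real ^ 'n ^ 'n"
  assumes AB: "A ** B = mat 1" and BA: "B ** A = mat 1"
    and c: "0 < c" "distr lborel borel ((*v) A) = density lborel (\<lambda>_. ennreal c)"
  shows "volume_scaling_biholomorphism (\<lambda>z. complexify A *v z + b)
    (\<lambda>z. complexify B *v (z - b)) (c\<^sup>2)"
proof
  note bl = linear_complex_matrix_vector_mult[THEN linear_linear[THEN iffD2]]
  have [measurable]: "(*v) (complexify A) \<in> borel_measurable borel"
    by (intro borel_measurable_continuous_onI linear_continuous_on bl)
  show "distr lborel borel (\<lambda>z. complexify A *v z + b) = density lborel (\<lambda>_. ennreal (c\<^sup>2))"
    by (intro distr_lborel_translate distr_lborel_complexify[OF c]) measurable
  fix z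
  show "\<exists>D. ((\<lambda>z. complexify A *v z + b) has_derivative D) (at z) \<and> (\<forall>c v. D (c *s v) = c *s D v)"
    by (intro exI[of _ "(*v) (complexify A)"])
       (auto intro!: derivative_eq_intros bounded_linear.has_derivative[OF bl] simp: vector_scalar_commute)
  show "\<exists>D. ((\<lambda>z. complexify B *v (z - b)) has_derivative D) (at z) \<and> (\<forall>c v. D (c *s v) = c *s D v)"
    by (intro exI[of _ "(*v) (complexify B)"])
       (auto intro!: derivative_eq_intros bounded_linear.has_derivative[OF bl] simp: vector_scalar_commute)
qed (use c in \<open>simp_all add: matrix_vector_mul_assoc complexify_mult complexify_mat_1 AB BA\<close>)

lemma complexify_imag_vec: "complexify A *v imag_vec y = imag_vec (A *v y)"
  by (simp add: complexify_def imag_vec_def matrix_vector_mult_def vec_eq_iff sum_distrib_left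
      mult.left_commute)

lemma imag_vec_add: "imag_vec (x + y) = imag_vec x + imag_vec y"
  by (simp add: imag_vec_def vec_eq_iff distrib_left)

lemma imag_vec_in_tube_domain: "imag_vec y \<in> tube_domain K \<longleftrightarrow> y \<in> interior K"
  by (simp add: imag_vec_def tube_domain_def)

lemma open_tube_domain:
  fixes K :: "(real ^ 'n) set"
  shows "open (tube_domain K)"
proof -
  have "continuous_on UNIV (\<lambda>z :: complex ^ 'n. \<chi> i. Im (z $ i))"
    by (intro continuous_intros)
  then have "open ((\<lambda>z :: complex ^ 'n. \<chi> i. Im (z $ i)) -` interior K)"
    by (intro open_vimage) auto
  then show ?thesis by (simp add: tube_domain_def vimage_def)
qed

lemma tube_domain_affine_image:
  fixes A B :: "real ^ 'n ^ 'n"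
  assumes K: "convex_body K" and AB: "A ** B = mat 1" and BA: "B ** A = mat 1"
  shows "tube_domain ((\<lambda>y. A *v y + a) ` K) = (\<lambda>z. complexify A *v z + imag_vec a) ` tube_domain K"
proof -
  have Im: "(\<chi> i. Im ((complexify A *v z + imag_vec a) $ i)) = A *v (\<chi> i. Im (z $ i)) + a" for z
    by (simp add: complexify_def imag_vec_def matrix_vector_mult_def vec_eq_iff)
  have inj: "inj (\<lambda>y. A *v y + a)"
    by (rule inj_on_inverseI[of _ "\<lambda>y. B *v (y - a)"]) (simp add: matrix_vector_mul_assoc BA)
  have mem: "complexify A *v z + imag_vec a \<in> tube_domain ((\<lambda>y. A *v y + a) ` K) \<longleftrightarrow> z \<in> tube_domain K" for z
    unfolding tube_domain_def convex_body_affine_image(2)[OF K BA]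
    by (simp only: mem_Collect_eq Im inj_image_mem_iff[OF inj])
  have surj: "w = complexify A *v (complexify B *v (w - imag_vec a)) + imag_vec a" for w
    by (simp add: matrix_vector_mul_assoc complexify_mult complexify_mat_1 AB)
  show ?thesis
  proof (intro equalityI subsetI)
    fix w assume "w \<in> tube_domain ((\<lambda>y. A *v y + a) ` K)"
    then show "w \<in> (\<lambda>z. complexify A *v z + imag_vec a) ` tube_domain K"
      using mem[of "complexify B *v (w - imag_vec a)"] surj[of w]
      by (intro image_eqI[of _ _ "complexify B *v (w - imag_vec a)"]) auto
  qed (use mem in auto)
qed

theorem lemma8:
  fixes K :: "(real ^ 'n) set" and A :: "real ^ 'n ^ 'n" and a :: "real ^ 'n"
  assumes "convex_body K"
    and "invertible A"
  shows "convex_body ((\<lambda>y. A *v y + a) ` K) \<and>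
         bergman_B ((\<lambda>y. A *v y + a) ` K) = bergman_B K"
proof
  obtain B where AB: "A ** B = mat 1" and BA: "B ** A = mat 1"
    using assms(2) by (auto simp: invertible_def)
  obtain c where c: "0 < c" "distr lborel borel ((*v) A) = density lborel (\<lambda>_. ennreal c)"
    by (rule distr_lborel_linear_bijection
        [OF matrix_vector_mul_linear[of A] matrix_vector_mul_linear[of B]])
       (simp_all add: matrix_vector_mul_assoc AB BA)
  interpret volume_scaling_biholomorphism "\<lambda>z. complexify A *v z + imag_vec a"
    "\<lambda>z. complexify B *v (z - imag_vec a)" "c\<^sup>2"
    by (rule volume_scaling_biholomorphism_complexify[OF AB BA c])
  let ?p = "imag_vec (barycenter K)"
  note affine = volume_and_barycenter_affine_image[OF assms(1) BA c, of a]
  show "convex_body ((\<lambda>y. A *v y + a) ` K)"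
    by (rule convex_body_affine_image[OF assms(1) BA])
  have p: "?p \<in> tube_domain K"
    by (simp add: imag_vec_in_tube_domain barycenter_in_interior assms(1))
  have Lp: "imag_vec (barycenter ((\<lambda>y. A *v y + a) ` K)) = complexify A *v ?p + imag_vec a"
    by (simp add: affine(2) imag_vec_add complexify_imag_vec)
  show "bergman_B ((\<lambda>y. A *v y + a) ` K) = bergman_B K"
    unfolding bergman_B_def tube_domain_affine_image[OF assms(1) AB BA] Lp
      bergman_kernel_image[OF open_tube_domain p p]
    by (simp add: affine(1) power_mult_distrib)
qed

end
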